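(* Let $n = p^r(p+2)^{r'}$, where either $r=r'=1$ and $p$, $p+2$ are both odd primes, or $r\ge 1$, $r'=0$ and $p$ is an odd prime. Let $A$ be a conference matrix of order $n$, let $q$ be a positive integer with $\gcd(n+1,q)=1$, let $d$ be an integer, and let $M\in\{0,1,\dots,q-1\}^n$ be a (column) message vector. Let $C$ be the encrypted message, i.e. an integer column vector of length $n$ with $$C\equiv AM+d\,e_n \pmod q .$$ Let $t$ be a solution of the congruence $(n+1)x\equiv 1 \pmod q$. Then the decrypted message $D\in\{0,1,\dots,q-1\}^n$ defined by $$D\equiv (I_n+J_n)\,A^T\,(C-d\,e_n)\,t \pmod q$$ is uniquely determined (in particular it does not depend on the choice of the solution $t$), and $D=M$.
   Context: A conference matrix of order $n$ here means an $n\times n$ matrix $A$ with all entries in $\{-1,1\}$ such that $A^TA=AA^T=(n+1)I_n-J_n$. Here $I_n$ is the $n\times n$ identity matrix, $J_n$ is the $n\times n$ matrix with all entries equal to $1$, and $e_n=(1,1,\dots,1)^T$ is the all-ones column vector of length $n$. Congruences of vectors modulo $q$ are entrywise. The encryption algorithm takes a plaintext block of length $n$, written as a column vector $M$ of integers modulo $q$, and outputs $C\equiv AM+d\,e_n\pmod q$. *)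

theory Defs
  imports
    "Jordan_Normal_Form.Matrix"
    "HOL-Number_Theory.Cong"
    "HOL-Computational_Algebra.Primes"
begin

definition all_ones_mat :: "nat \<Rightarrow> int mat" where
  "all_ones_mat n = mat n n (\<lambda>(i, j). 1)"

definition all_ones_vec :: "nat \<Rightarrow> int vec" where
  "all_ones_vec n = vec n (\<lambda>i. 1)"

text \<open>This is not the classical notion (zero diagonal and
  \<open>A A\<^sup>T = (n - 1) I\<close>): here all entries are \<open>\<plusminus>1\<close> and \<open>A\<^sup>T A = A A\<^sup>T = (n + 1) I - J\<close>.\<close>

definition conference_mat :: "nat \<Rightarrow> int mat \<Rightarrow> bool" where
  "conference_mat n A \<longleftrightarrow>
     A \<in> carrier_mat n n \<and>
     (\<forall>i<n. \<forall>j<n. A $$ (i, j) \<in> {-1, 1}) \<and>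
     transpose_mat A * A = (int n + 1) \<cdot>\<^sub>m 1\<^sub>m n - all_ones_mat n \<and>
     A * transpose_mat A = (int n + 1) \<cdot>\<^sub>m 1\<^sub>m n - all_ones_mat n"

definition vec_cong :: "int \<Rightarrow> int vec \<Rightarrow> int vec \<Rightarrow> bool" where
  "vec_cong q v w \<longleftrightarrow> dim_vec v = dim_vec w \<and> (\<forall>i<dim_vec w. [v $ i = w $ i] (mod q))"

definition message_blocks :: "nat \<Rightarrow> int \<Rightarrow> int vec set" where
  "message_blocks n q = {M \<in> carrier_vec n. \<forall>i<n. M $ i \<in> {0..<q}}"

text \<open>The ciphertext and the decrypted message are given by congruences, so both are
  rendered as relations rather than as functions.\<close>

definition is_encryption ::
    "nat \<Rightarrow> int \<Rightarrow> int mat \<Rightarrow> int \<Rightarrow> int vec \<Rightarrow> int vec \<Rightarrow> bool" where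
  "is_encryption n q A d M C \<longleftrightarrow>
     C \<in> carrier_vec n \<and> vec_cong q C (A *\<^sub>v M + d \<cdot>\<^sub>v all_ones_vec n)"

definition is_decryption ::
    "nat \<Rightarrow> int \<Rightarrow> int mat \<Rightarrow> int \<Rightarrow> int \<Rightarrow> int vec \<Rightarrow> int vec \<Rightarrow> bool" where
  "is_decryption n q A d t C D \<longleftrightarrow>
     D \<in> message_blocks n q \<and>
     vec_cong q D
       (t \<cdot>\<^sub>v (((1\<^sub>m n + all_ones_mat n) * transpose_mat A) *\<^sub>v (C - d \<cdot>\<^sub>v all_ones_vec n)))"

end

theory Submission imports Defs begin

text \<open>Since \<open>J\<^sup>2 = n J\<close>, the matrix \<open>I + J\<close> satisfies
  \<open>(I + J) ((n + 1) I - J) = (n + 1) I\<close>. Hence \<open>(I + J) A\<^sup>T\<close> is a left inverse of \<open>A\<close> up to the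
  factor \<open>n + 1\<close>, which \<open>t\<close> cancels modulo \<open>q\<close>; a residue vector with entries in
  \<open>{0..<q}\<close> is determined by its congruence class.\<close>

lemma all_ones_mat_carrier [simp]: "all_ones_mat n \<in> carrier_mat n n"
  by (simp add: all_ones_mat_def)

lemma all_ones_mat_square: "all_ones_mat n * all_ones_mat n = int n \<cdot>\<^sub>m all_ones_mat n"
  by (rule eq_matI) (auto simp: all_ones_mat_def scalar_prod_def)

text \<open>Expanding the first factor leaves the second factor \<open>?K\<close> plus
  \<open>?J * ?K\<close>. The latter is \<open>(n + 1) ?J - n ?J = ?J\<close>, which restores
  exactly the \<open>?J\<close> subtracted in \<open>?K\<close>.\<close>

lemma one_plus_all_ones_mult:
  "(1\<^sub>m n + all_ones_mat n) * ((int n + 1) \<cdot>\<^sub>m 1\<^sub>m n - all_ones_mat n) = (int n + 1) \<cdot>\<^sub>m 1\<^sub>m n"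
proof -
  let ?J = "all_ones_mat n" and ?K = "(int n + 1) \<cdot>\<^sub>m 1\<^sub>m n - all_ones_mat n"
  have K: "?K \<in> carrier_mat n n"
    by (simp add: minus_carrier_mat)
  have "?J * ?K = ?J * ((int n + 1) \<cdot>\<^sub>m 1\<^sub>m n) - ?J * ?J"
    by (rule mult_minus_distrib_mat[of _ n n _ n]) auto
  also have "?J * ((int n + 1) \<cdot>\<^sub>m 1\<^sub>m n) = (int n + 1) \<cdot>\<^sub>m ?J"
    using mult_smult_distrib[OF all_ones_mat_carrier one_carrier_mat]
      right_mult_one_mat[OF all_ones_mat_carrier] by simp
  also have "(int n + 1) \<cdot>\<^sub>m ?J - ?J * ?J = ?J"
    unfolding all_ones_mat_square by (rule eq_matI) (auto simp: all_ones_mat_def)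
  finally have JK: "?J * ?K = ?J" .
  have "(1\<^sub>m n + ?J) * ?K = ?K + ?J * ?K"
    using add_mult_distrib_mat[OF one_carrier_mat all_ones_mat_carrier K] left_mult_one_mat[OF K]
    by simp
  also have "\<dots> = (int n + 1) \<cdot>\<^sub>m 1\<^sub>m n"
    unfolding JK by (rule eq_matI) (auto simp: all_ones_mat_def)
  finally show ?thesis .
qed

text \<open>Reassociating the product exposes \<open>transpose_mat A * A\<close>, whose value is
  known from \<open>conference_mat\<close>.\<close>

lemma conference_mat_left_inverse:
  assumes "conference_mat n A"
  shows "((1\<^sub>m n + all_ones_mat n) * transpose_mat A) * A = (int n + 1) \<cdot>\<^sub>m 1\<^sub>m n"
proof -
  have A: "A \<in> carrier_mat n n" "transpose_mat A * A = (int n + 1) \<cdot>\<^sub>m 1\<^sub>m n - all_ones_mat n"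
    using assms by (auto simp: conference_mat_def)
  have "((1\<^sub>m n + all_ones_mat n) * transpose_mat A) * A
      = (1\<^sub>m n + all_ones_mat n) * (transpose_mat A * A)"
    using A(1) by (intro assoc_mult_mat[of _ n n _ n _ n]) (auto intro: add_carrier_mat)
  then show ?thesis
    by (simp add: A(2) one_plus_all_ones_mult)
qed

lemma vec_cong_sym: "vec_cong q v w \<Longrightarrow> vec_cong q w v"
  by (auto simp: vec_cong_def cong_sym)

lemma vec_cong_trans: "vec_cong q u v \<Longrightarrow> vec_cong q v w \<Longrightarrow> vec_cong q u w"
  by (auto simp: vec_cong_def intro: cong_trans)

lemma vec_cong_smult: "vec_cong q v w \<Longrightarrow> vec_cong q (c \<cdot>\<^sub>v v) (c \<cdot>\<^sub>v w)"
  by (auto simp: vec_cong_def intro: cong_scalar_left)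

text \<open>The sum in \<open>scalar_prod\<close> runs over the dimension of its second argument,
  and \<open>vec_cong\<close> equates these dimensions, so \<open>P\<close> may have any
  shape.\<close>

lemma vec_cong_mult_mat_vec: "vec_cong q v w \<Longrightarrow> vec_cong q (P *\<^sub>v v) (P *\<^sub>v w)"
  by (auto simp: vec_cong_def scalar_prod_def intro!: cong_sum cong_scalar_left)

lemma message_blocks_cong_imp_eq:
  assumes "D \<in> message_blocks n q" "M \<in> message_blocks n q" "vec_cong q D M"
  shows "D = M"
proof (rule eq_vecI)
  show "dim_vec D = dim_vec M"
    using assms(3) by (simp add: vec_cong_def)
  fix i
  assume "i < dim_vec M"
  with assms have "[D $ i = M $ i] (mod q)" "D $ i \<in> {0..<q}" "M $ i \<in> {0..<q}"
    by (auto simp: message_blocks_def vec_cong_def)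
  then show "D $ i = M $ i"
    \<comment> \<open>Reduction modulo \<open>q\<close> is the identity on
      \<open>{0..<q}\<close>.\<close>
    by (simp add: cong_def)
qed

text \<open>Correctness at the level of residue classes, before representatives in
  \<open>{0..<q}\<close> are chosen.\<close>

lemma decryption_vec_cong_message:
  assumes conf: "conference_mat n A" and M: "M \<in> carrier_vec n"
    and C: "is_encryption n q A d M C"
    and t: "[(int n + 1) * t = 1] (mod q)"
  shows "vec_cong q
    (t \<cdot>\<^sub>v (((1\<^sub>m n + all_ones_mat n) * transpose_mat A) *\<^sub>v (C - d \<cdot>\<^sub>v all_ones_vec n))) M"
proof -
  define P where "P = (1\<^sub>m n + all_ones_mat n) * transpose_mat A"
  have A: "A \<in> carrier_mat n n"
    using conf by (simp add: conference_mat_def)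
  have P: "P \<in> carrier_mat n n"
    using A unfolding P_def by (intro mult_carrier_mat[of _ n n] add_carrier_mat) auto
  have "vec_cong q (C - d \<cdot>\<^sub>v all_ones_vec n) (A *\<^sub>v M)"
    unfolding vec_cong_def
  proof (intro conjI allI impI)
    \<comment> \<open>A difference of vectors takes its dimension from the subtrahend, here the
      all-ones vector of length \<open>n\<close>.\<close>
    show "dim_vec (C - d \<cdot>\<^sub>v all_ones_vec n) = dim_vec (A *\<^sub>v M)"
      using A by (simp add: all_ones_vec_def)
    fix i
    assume "i < dim_vec (A *\<^sub>v M)"
    then have i: "i < n"
      using A by simp
    then have "[C $ i = (A *\<^sub>v M) $ i + d] (mod q)"
      using C A by (auto simp: is_encryption_def vec_cong_def all_ones_vec_def)
    then have "[C $ i - d = (A *\<^sub>v M) $ i + d - d] (mod q)"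
      by (intro cong_diff cong_refl)
    then show "[(C - d \<cdot>\<^sub>v all_ones_vec n) $ i = (A *\<^sub>v M) $ i] (mod q)"
      using i by (simp add: all_ones_vec_def)
  qed
  then have "vec_cong q (t \<cdot>\<^sub>v (P *\<^sub>v (C - d \<cdot>\<^sub>v all_ones_vec n))) (t \<cdot>\<^sub>v (P *\<^sub>v (A *\<^sub>v M)))"
    by (intro vec_cong_smult vec_cong_mult_mat_vec)
  moreover have "P *\<^sub>v (A *\<^sub>v M) = (int n + 1) \<cdot>\<^sub>v M"
  proof -
    have "P *\<^sub>v (A *\<^sub>v M) = (P * A) *\<^sub>v M"
      using assoc_mult_mat_vec[OF P A M] by simp
    also have "\<dots> = ((int n + 1) \<cdot>\<^sub>m 1\<^sub>m n) *\<^sub>v M"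
      by (simp add: P_def conference_mat_left_inverse[OF conf])
    also have "\<dots> = (int n + 1) \<cdot>\<^sub>v M"
      using M by (intro eq_vecI) auto
    finally show ?thesis .
  qed
  moreover have "vec_cong q (t \<cdot>\<^sub>v ((int n + 1) \<cdot>\<^sub>v M)) M"
    unfolding vec_cong_def
  proof (intro conjI allI impI)
    fix i
    assume "i < dim_vec M"
    then show "[(t \<cdot>\<^sub>v ((int n + 1) \<cdot>\<^sub>v M)) $ i = M $ i] (mod q)"
      \<comment> \<open>Multiplying the congruence for \<open>t\<close> by the entry
        \<open>M $ i\<close> cancels the factor \<open>n + 1\<close>.\<close>
      using cong_scalar_right[OF t, of "M $ i"] by (simp add: algebra_simps)
  qed simp
  ultimately show ?thesis
    unfolding P_def by (metis vec_cong_trans)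
qed

text \<open>The right-hand side does not mention \<open>t\<close>, so this one equivalence yields
  existence, uniqueness, independence of the chosen inverse and correctness together.\<close>

lemma is_decryption_iff:
  assumes "conference_mat n A" "M \<in> message_blocks n q"
    and "is_encryption n q A d M C" "[(int n + 1) * t = 1] (mod q)"
  shows "is_decryption n q A d t C D \<longleftrightarrow> D = M"
proof -
  have "M \<in> carrier_vec n"
    using assms(2) by (simp add: message_blocks_def)
  note cong = decryption_vec_cong_message[OF assms(1) this assms(3,4)]
  show ?thesis
    \<comment> \<open>From left to right, transitivity gives \<open>vec_cong q D M\<close> and both
      vectors are reduced; from right to left, \<open>M\<close> is itself a reduced vector
      satisfying the congruence, by symmetry.\<close>
    using assms(2) message_blocks_cong_imp_eq vec_cong_trans[OF _ cong] vec_cong_sym[OF cong]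
    unfolding is_decryption_def by blast
qed

theorem theorem3p1:
  fixes p r r' n :: nat and q d t :: int and A :: "int mat" and M C :: "int vec"
  assumes n_eq: "n = p ^ r * (p + 2) ^ r'"
    and exponents: "(r = 1 \<and> r' = 1 \<and> prime p \<and> odd p \<and> prime (p + 2) \<and> odd (p + 2))
                    \<or> (r \<ge> 1 \<and> r' = 0 \<and> prime p \<and> odd p)"
    and conference: "conference_mat n A"
    and q_pos: "q > 0"
    and q_coprime: "gcd (int n + 1) q = 1"
    and message: "M \<in> message_blocks n q"
    and ciphertext: "is_encryption n q A d M C"
    and t_inverse: "[(int n + 1) * t = 1] (mod q)"
  shows "(\<exists>!D. is_decryption n q A d t C D)
       \<and> (\<forall>t'. [(int n + 1) * t' = 1] (mod q) \<longrightarrow>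
            (\<forall>D. is_decryption n q A d t' C D \<longleftrightarrow> is_decryption n q A d t C D))
       \<and> (\<forall>D. is_decryption n q A d t C D \<longrightarrow> D = M)"
  using is_decryption_iff[OF conference message ciphertext] t_inverse by simp

end
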